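(* Let $m\ge 1$ and $n\ge 2$ be integers and let $S(2m+1,n)=\sum_{j=1}^{2^{n-2}}\frac{1}{\sin^{2m+1}\left(\frac{(2j-1)\pi}{2^n}\right)}$. Then $$S(2m+1,n)=(-1)^m\frac{2^{2mn}}{(2m)!}\sum_{j=1}^{2^{n-2}}\left(\sum_{k=0}^{m-1}\frac{1}{2^{(n-1)(2k+1)}}\binom{2m-1}{2k}B_{2k}^{(2m)}(m)\left(2^{n-1}E_{2m-2k}\left(\tfrac{j}{2^{n-1}}\right)-mE_{2m-2k-1}\left(\tfrac{j}{2^{n-1}}\right)\right)\right)\frac{1}{\sin\left(\frac{(2j-1)\pi}{2^n}\right)}.$$ Equivalently, $$S(2m+1,n)=(-1)^m\frac{1}{(2m)!}\sum_{j=1}^{2^{n-2}}\Biggl((j-m)B_{2m-1}^{(2m)}(m+j)+2^{2mn}\sum_{k=0}^{m-1}E_{2m-2k-1}(0)\frac{1}{2^{(n-1)(2k+1)}}\left(\binom{2m-1}{2k+1}B_{2k+1}^{(2m)}(m+j)+(j-m)\binom{2m-1}{2k}B_{2k}^{(2m)}(m+j)\right)\Biggr)\frac{1}{\sin\left(\frac{(2j-1)\pi}{2^n}\right)}.$$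
   Context: The generalized Bernoulli polynomials $B_n^{(\alpha)}(x)$ are defined by $\left(\frac{t}{e^t-1}\right)^\alpha e^{xt}=\sum_{n\ge 0} B_n^{(\alpha)}(x)\frac{t^n}{n!}$. The Euler polynomials $E_n(x)$ are defined by $\frac{2}{e^t+1}e^{xt}=\sum_{n\ge 0}E_n(x)\frac{t^n}{n!}$.
   Formalization: The second formula is false as printed (for m=1, n=3 it gives about 22.36, while S(3,3) is about 19.11); the formal version multiplies the term (j-m)B_{2m-1}^{(2m)}(m+j) by the missing factor 2^{2m}. *)

theory Defs
  imports "HOL-Analysis.Analysis" "HOL-Computational_Algebra.Formal_Power_Series"
begin

(* The power F^\<alpha> of a formal power series F with constant term 1 is the binomial series
   (1 + X)^\<alpha> composed with F - 1; fps_powr_of_nat shows that it is the usual power when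
   \<alpha> is a natural number. *)
definition fps_powr :: "'a::field_char_0 fps \<Rightarrow> 'a \<Rightarrow> 'a fps" where
  "fps_powr F \<alpha> = fps_binomial \<alpha> oo (F - 1)"

definition gen_bernoulli :: "'a::field_char_0 \<Rightarrow> nat \<Rightarrow> 'a \<Rightarrow> 'a" where
  "gen_bernoulli \<alpha> n x =
     fact n * fps_nth (fps_powr (fps_X / (fps_exp 1 - 1)) \<alpha> * fps_exp x) n"

definition euler_poly :: "nat \<Rightarrow> 'a::field_char_0 \<Rightarrow> 'a" where
  "euler_poly n x = fact n * fps_nth (2 / (fps_exp 1 + 1) * fps_exp x) n"

definition csc_sum :: "nat \<Rightarrow> nat \<Rightarrow> real" where
  "csc_sum p n = (\<Sum>j = 1..2 ^ (n - 2). 1 / sin ((2 * real j - 1) * pi / 2 ^ n) ^ p)"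

lemma fps_powr_of_nat:
  fixes F :: "'a::field_char_0 fps"
  assumes "fps_nth F 0 = 1"
  shows "fps_powr F (of_nat a) = F ^ a"
  using assms
  by (simp add: fps_powr_def fps_binomial_of_nat fps_compose_power [symmetric]
      fps_compose_add_distrib)

lemma fps_exp_minus_1_eq:
  "fps_exp (1::'a::field_char_0) - 1 = fps_X * Abs_fps (\<lambda>n. 1 / fact (Suc n))"
  by (rule fps_ext) (auto simp: fps_X_mult_nth fact_reduce)

lemma bernoulli_gf_nth_0:
  "fps_nth (fps_X / (fps_exp (1::'a::field_char_0) - 1)) 0 = 1"
proof -
  let ?G = "Abs_fps (\<lambda>n. 1 / fact (Suc n)) :: 'a fps"
  have G0: "fps_nth ?G 0 = 1" by simp
  have "fps_X / (fps_exp (1::'a) - 1) = (fps_X * 1) / (fps_X * ?G)"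
    by (simp add: fps_exp_minus_1_eq)
  also have "\<dots> = 1 / ?G"
    by (rule div_mult_mult1) simp
  also have "\<dots> = inverse ?G"
    using G0 by (simp add: fps_divide_unit)
  finally show ?thesis using G0 by simp
qed

lemma gen_bernoulli_of_nat:
  "gen_bernoulli (of_nat a) n (x::'a::field_char_0) =
     fact n * fps_nth ((fps_X / (fps_exp 1 - 1)) ^ a * fps_exp x) n"
  by (simp add: gen_bernoulli_def fps_powr_of_nat bernoulli_gf_nth_0)

lemma gen_bernoulli_gf:
  "fps_powr (fps_X / (fps_exp 1 - 1)) \<alpha> * fps_exp (x::'a::field_char_0) =
     Abs_fps (\<lambda>n. gen_bernoulli \<alpha> n x / fact n)"
  by (rule fps_ext) (simp add: gen_bernoulli_def)

lemma euler_poly_gf: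
  "2 / (fps_exp 1 + 1) * fps_exp (x::'a::field_char_0) =
     Abs_fps (\<lambda>n. euler_poly n x / fact n)"
  by (rule fps_ext) (simp add: euler_poly_def)

end

(* Put q = 2^(n-1) and theta_j = (2j-1) pi / (2q). Both right-hand sides have the form
   sum_j c_m(j) / sin theta_j with the same numbers c_m(j), namely (-4)^m / (2m) times the residue
   at 0 of sigma^(-2m) (W' - m W), where sigma = 2 sinh (t/2) and W = 2 e^(jt) / (e^(qt) + 1);
   the two formulas are two ways of expanding this residue.

   Since derivatives have residue 0 and 2 cosh t - 2 = sigma^2, the second difference of c_m
   in j is -4 c_(m-1), while c_m(q+1-j) = c_m(j) and c_m(0) + c_m(1) = 0. As
   sin ((2r-1) theta) has second difference -4 sin^2 theta sin ((2r-1) theta) in r, summation by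
   parts and induction on m give sum_(r=1)^q c_m(r) sin ((2r-1) theta) = 1 / sin^(2m+1) theta for
   theta = theta_j. Now sum over j <= q/2, exchange the sums and use
   sum_j sin ((2r-1) theta_j) = 1 / (2 sin theta_r). *)

theory Submission
  imports Defs
begin

section \<open>Power series of the hyperbolic sine and cosecant\<close>

definition fps_two_sinh_half :: "real fps" where
  "fps_two_sinh_half = fps_exp (1 / 2) - fps_exp (- 1 / 2)"

text \<open>The series of \<open>(t / 2) / sinh (t / 2)\<close>, as \<open>e^t - 1\<close> is
  \<open>e^(t/2)\<close> times \<open>2 sinh (t / 2)\<close>. The factor \<open>t\<close> removes
  the pole, so residues become ordinary coefficients.\<close>

definition fps_half_csch :: "real fps" where
  "fps_half_csch = fps_X / (fps_exp 1 - 1) * fps_exp (1 / 2)"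

text \<open>For \<open>p \<ge> 1\<close> this is the residue at 0 of \<open>F / (2 sinh (t / 2)) ^ p\<close>.\<close>
definition csch_residue :: "nat \<Rightarrow> real fps \<Rightarrow> real" where
  "csch_residue p F = fps_nth (fps_half_csch ^ p * F) (p - 1)"

definition euler_gf :: "real \<Rightarrow> real \<Rightarrow> real fps" where
  "euler_gf q x = 2 / (fps_exp q + 1) * fps_exp x"

text \<open>The numbers \<open>c_m(x)\<close> for general \<open>q\<close>. The residue formula
  divides by \<open>2 * m\<close>, so \<open>m = 0\<close> is set apart; the value 1 there makes the
  second-difference equation hold from \<open>m = 0\<close> on. A real \<open>x\<close> permits the
  shifts by 1/2 and below 0.\<close>

definition csc_coeff :: "real \<Rightarrow> nat \<Rightarrow> real \<Rightarrow> real" where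
  "csc_coeff q m x = (if m = 0 then 1 else
     (- 4) ^ m / (2 * m) *
     csch_residue (2 * m) (fps_deriv (euler_gf q x) - of_nat m * euler_gf q x))"

text \<open>The divisor is not a unit, but it is \<open>fps_X\<close> times a unit and so divides
  \<open>fps_X\<close> exactly.\<close>

lemma bernoulli_gf_mult:
  "fps_X / (fps_exp (1::'a::field_char_0) - 1) * (fps_exp 1 - 1) = fps_X"
proof -
  let ?G = "Abs_fps (\<lambda>n. 1 / fact (Suc n)) :: 'a fps"
  have "?G * inverse ?G = 1"
    by (rule inverse_mult_eq_1') simp
  then have "fps_X = (fps_exp (1::'a) - 1) * inverse ?G"
    by (simp add: fps_exp_minus_1_eq mult.assoc)
  then have "fps_exp (1::'a) - 1 dvd fps_X"
    by (metis dvd_triv_left)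
  then show ?thesis
    by (rule dvd_div_mult_self)
qed

lemma fps_half_csch_mult_sinh: "fps_half_csch * fps_two_sinh_half = fps_X"
proof -
  have "fps_exp (1 / 2) * fps_two_sinh_half = fps_exp 1 - 1"
    by (simp add: fps_two_sinh_half_def right_diff_distrib fps_exp_add_mult [symmetric])
  then show ?thesis
    by (metis (no_types) fps_half_csch_def bernoulli_gf_mult mult.assoc)
qed

lemma fps_half_csch_power:
  "fps_half_csch ^ p = (fps_X / (fps_exp 1 - 1)) ^ p * fps_exp (real p / 2)"
  by (simp add: fps_half_csch_def power_mult_distrib fps_exp_power_mult)

lemma fps_half_csch_nth_0 [simp]: "fps_nth fps_half_csch 0 = 1"
  by (simp add: fps_half_csch_def bernoulli_gf_nth_0)

text \<open>The \<open>2 * m\<close> factors \<open>e^(t/2)\<close> multiply to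
  \<open>e^(mt)\<close>, which accounts for the shift by \<open>m\<close> in the argument.\<close>

lemma gen_bernoulli_half_csch:
  "gen_bernoulli (real (2 * m)) k (real m + x) =
     fact k * fps_nth (fps_half_csch ^ (2 * m) * fps_exp x) k"
  unfolding gen_bernoulli_of_nat
  by (simp add: fps_half_csch_power fps_exp_add_mult mult.assoc)

lemma fps_compose_uminus_X_nth:
  "fps_nth (F oo - fps_X) k = (- 1) ^ k * fps_nth (F :: 'a::comm_ring_1 fps) k"
proof -
  have "(- fps_X :: 'a fps) = fps_const (- 1) * fps_X"
    by (rule fps_ext) simp
  then show ?thesis
    by (simp only: fps_compose_linear fps_nth_Abs_fps)
qed

lemma fps_exp_compose_uminus_X: "fps_exp c oo - fps_X = fps_exp (- c :: 'a::field_char_0)"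
  using fps_exp_compose_linear [of c "- 1"] by simp

text \<open>A quotient of two odd series, \<open>t\<close> and \<open>2 sinh (t / 2)\<close>, is
  even.\<close>

lemma fps_half_csch_compose_uminus: "fps_half_csch oo - fps_X = fps_half_csch"
proof -
  have "(fps_half_csch oo - fps_X) * (fps_two_sinh_half oo - fps_X) = - fps_X"
    by (subst fps_compose_mult_distrib [symmetric]) (simp_all add: fps_half_csch_mult_sinh)
  moreover have "fps_two_sinh_half oo - fps_X = - fps_two_sinh_half"
    by (simp add: fps_two_sinh_half_def fps_compose_sub_distrib fps_exp_compose_uminus_X)
  ultimately have "(fps_half_csch oo - fps_X) * fps_two_sinh_half =
      fps_half_csch * fps_two_sinh_half"
    by (simp add: fps_half_csch_mult_sinh)
  moreover have "fps_two_sinh_half \<noteq> 0"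
    using fps_half_csch_mult_sinh by auto
  ultimately show ?thesis
    by simp
qed

lemma fps_half_csch_power_nth_odd:
  assumes "odd k"
  shows "fps_nth (fps_half_csch ^ p) k = 0"
proof -
  have "(fps_half_csch ^ p) oo - fps_X = fps_half_csch ^ p"
    by (simp add: fps_compose_power [symmetric] fps_half_csch_compose_uminus)
  then have "fps_nth (fps_half_csch ^ p) k = (- 1) ^ k * fps_nth (fps_half_csch ^ p) k"
    by (metis fps_compose_uminus_X_nth)
  with assms show ?thesis
    by simp
qed

section \<open>Calculus of residues at 0\<close>

lemma csch_residue_add: "csch_residue p (F + G) = csch_residue p F + csch_residue p G"
  by (simp add: csch_residue_def distrib_left)

lemma csch_residue_diff: "csch_residue p (F - G) = csch_residue p F - csch_residue p G"
  by (simp add: csch_residue_def right_diff_distrib)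

lemma csch_residue_of_nat: "csch_residue p (of_nat c * F) = of_nat c * csch_residue p F"
  by (simp add: csch_residue_def mult.left_commute [of _ "fps_const (real c)"] flip: fps_of_nat)

text \<open>One factor cancels between numerator and denominator. At \<open>p = 0\<close> the
  truncated index \<open>p - 1\<close> would read off the constant term of \<open>F\<close> instead
  of a residue.\<close>

lemma csch_residue_sinh:
  assumes "p \<ge> 1"
  shows "csch_residue (Suc p) (fps_two_sinh_half * F) = csch_residue p F"
proof -
  have "fps_half_csch ^ Suc p * (fps_two_sinh_half * F) =
      fps_X * (fps_half_csch ^ p * F)"
    unfolding fps_half_csch_mult_sinh [symmetric] by (simp only: power_Suc mult_ac)
  then show ?thesis
    unfolding csch_residue_def by (simp only:) (use assms in simp)
qed

text \<open>Equivalent to the vanishing of the residue of the derivative of \<open>F / (2 sinh (t / 2)) ^ p\<close>.\<close>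
lemma csch_residue_deriv:
  assumes "p \<ge> 1"
  shows "csch_residue p (fps_deriv F) =
    real p * csch_residue (Suc p) (fps_deriv fps_two_sinh_half * F)"
proof -
  let ?A = fps_half_csch and ?S = fps_two_sinh_half
  obtain k where p: "p = Suc k"
    using assms by (cases p) auto
  have "fps_deriv (?A * ?S) = 1"
    by (simp add: fps_half_csch_mult_sinh)
  \<comment> \<open>The product rule for \<open>?A * ?S = fps_X\<close>, multiplied by
    \<open>?A\<close>, trades the derivative of \<open>?A\<close> for that of
    \<open>?S\<close>.\<close>
  then have "?A * (fps_deriv ?A * ?S + ?A * fps_deriv ?S) = ?A"
    by (simp add: algebra_simps)
  then have XA: "fps_X * fps_deriv ?A = ?A - ?A * ?A * fps_deriv ?S"
    by (simp add: fps_half_csch_mult_sinh [symmetric] algebra_simps)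
  have "fps_deriv (?A ^ p * F) = ?A ^ p * fps_deriv F + fps_const (real p) * (fps_deriv ?A * ?A ^ k * F)"
    by (simp add: p fps_deriv_power [of _ "Suc k"] mult_ac del: of_nat_Suc power_Suc)
  then have "fps_nth (fps_deriv (?A ^ p * F)) k =
      csch_residue p (fps_deriv F) + real p * fps_nth (fps_deriv ?A * ?A ^ k * F) k"
    by (simp add: csch_residue_def p del: of_nat_Suc power_Suc fps_deriv_mult)
  moreover have "fps_nth (fps_deriv (?A ^ p * F)) k = real p * fps_nth (?A ^ p * F) p"
    by (simp only: fps_deriv_nth p Suc_eq_plus1)
  moreover have "fps_nth (fps_deriv ?A * ?A ^ k * F) k =
      fps_nth (?A ^ p * F) p - csch_residue (Suc p) (fps_deriv ?S * F)"
  proof -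
    have "fps_nth (fps_deriv ?A * ?A ^ k * F) k = fps_nth (fps_X * fps_deriv ?A * ?A ^ k * F) p"
      by (simp add: p mult.assoc)
    also have "fps_X * fps_deriv ?A * ?A ^ k * F = ?A ^ p * F - ?A ^ Suc p * (fps_deriv ?S * F)"
      unfolding XA by (simp add: p algebra_simps)
    finally show ?thesis
      by (simp add: csch_residue_def del: power_Suc)
  qed
  \<comment> \<open>The coefficient \<open>fps_nth (?A ^ p * F) p\<close> occurs with factor
    \<open>real p\<close> in both evaluations and cancels.\<close>
  ultimately show ?thesis
    by (simp add: right_diff_distrib)
qed

text \<open>\<open>csch_residue_deriv\<close> raises the order of the pole by one, and the extra
  factor \<open>fps_two_sinh_half\<close> lowers it again.\<close>

lemma csch_residue_deriv_sinh:
  assumes "p \<ge> 1"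
  shows "csch_residue p (fps_deriv (fps_two_sinh_half * F)) =
    real p * csch_residue p (fps_deriv fps_two_sinh_half * F)"
proof -
  have "fps_deriv fps_two_sinh_half * (fps_two_sinh_half * F) =
      fps_two_sinh_half * (fps_deriv fps_two_sinh_half * F)"
    by (simp add: mult_ac)
  then show ?thesis
    by (simp only: csch_residue_deriv [OF assms] csch_residue_sinh [OF assms])
qed

text \<open>Powers of \<open>fps_half_csch\<close> are even, and the index \<open>p - 1\<close> is
  odd.\<close>

lemma csch_residue_compose_uminus:
  assumes "even p" "p \<ge> 1"
  shows "csch_residue p (F oo - fps_X) = - csch_residue p F"
proof -
  have "fps_half_csch ^ p * (F oo - fps_X) = (fps_half_csch ^ p * F) oo - fps_X"
    by (simp add: fps_compose_mult_distrib fps_compose_power [symmetric] fps_half_csch_compose_uminus)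
  moreover have "odd (p - 1)"
    using assms by simp
  ultimately show ?thesis
    by (simp add: csch_residue_def fps_compose_uminus_X_nth)
qed

section \<open>The rescaled generating function of the Euler polynomials\<close>

lemma euler_gf_mult: "euler_gf q x * (fps_exp q + 1) = 2 * fps_exp x"
proof -
  have "fps_nth (fps_exp q + 1) 0 \<noteq> 0"
    by simp
  then have "2 / (fps_exp q + 1) * (fps_exp q + 1) = 2"
    by (simp add: fps_divide_unit mult.assoc inverse_mult_eq_1)
  then show ?thesis
    by (metis (no_types) euler_gf_def mult.assoc mult.commute)
qed

text \<open>Lets a series be recognised as \<open>euler_gf q x\<close> without handling the
  quotient.\<close>

lemma euler_gf_eqI:
  assumes "F * (fps_exp q + 1) = 2 * fps_exp x"
  shows "F = euler_gf q x"
proof -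
  have "fps_nth (fps_exp q + 1) 0 \<noteq> 0"
    by simp
  then have "fps_exp q + 1 \<noteq> 0"
    by force
  moreover have "F * (fps_exp q + 1) = euler_gf q x * (fps_exp q + 1)"
    by (simp add: assms euler_gf_mult)
  ultimately show ?thesis
    by simp
qed

lemma euler_gf_nth_0 [simp]: "fps_nth (euler_gf q x) 0 = 1"
  by (simp add: euler_gf_def fps_divide_unit)

lemma fps_exp_mult_euler_gf: "fps_exp c * euler_gf q x = euler_gf q (c + x)"
  by (simp add: euler_gf_def fps_exp_add_mult mult_ac)

text \<open>The fraction \<open>2 e^(-xt) / (e^(-qt) + 1)\<close> is extended by
  \<open>e^(qt)\<close>.\<close>

lemma euler_gf_compose_uminus: "euler_gf q x oo - fps_X = euler_gf q (q - x)"
proof (rule euler_gf_eqI)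
  have "(euler_gf q x oo - fps_X) * (fps_exp (- q) + 1) =
      (euler_gf q x * (fps_exp q + 1)) oo - fps_X"
    by (simp add: fps_compose_mult_distrib fps_compose_add_distrib fps_exp_compose_uminus_X)
  also have "\<dots> = 2 * fps_exp (- x)"
    by (simp add: euler_gf_mult fps_compose_mult_distrib fps_exp_compose_uminus_X
        flip: numeral_fps_const)
  finally have reflected: "(euler_gf q x oo - fps_X) * (fps_exp (- q) + 1) = 2 * fps_exp (- x)" .
  have "fps_exp q + 1 = fps_exp q * (fps_exp (- q) + 1)"
    by (simp add: distrib_left fps_exp_add_mult [symmetric])
  then have "(euler_gf q x oo - fps_X) * (fps_exp q + 1) =
      fps_exp q * ((euler_gf q x oo - fps_X) * (fps_exp (- q) + 1))"
    by (simp only: mult.left_commute)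
  also have "\<dots> = 2 * (fps_exp q * fps_exp (- x))"
    by (simp only: reflected mult.left_commute)
  also have "\<dots> = 2 * fps_exp (q - x)"
    by (simp flip: fps_exp_add_mult)
  finally show "(euler_gf q x oo - fps_X) * (fps_exp q + 1) = 2 * fps_exp (q - x)" .
qed

lemma euler_gf_add_period: "euler_gf q x + euler_gf q (q + x) = 2 * fps_exp x"
  using euler_gf_mult [of q x] by (simp add: algebra_simps flip: fps_exp_mult_euler_gf)

text \<open>Substituting \<open>q t\<close> for \<open>t\<close> turns the classical generating
  function at \<open>x / q\<close> into \<open>euler_gf q x\<close>.\<close>

lemma euler_gf_nth:
  assumes "q \<noteq> 0"
  shows "fps_nth (euler_gf q x) k = q ^ k * euler_poly k (x / q) / fact k"
proof -
  let ?E = "2 / (fps_exp 1 + 1) * fps_exp (x / q) :: real fps"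
  have "fps_nth (fps_exp (1::real) + 1) 0 \<noteq> 0"
    by simp
  then have "?E * (fps_exp 1 + 1) = 2 * fps_exp (x / q)"
    using euler_gf_mult [of 1 "x / q"] by (simp add: euler_gf_def)
  moreover have "fps_nth (fps_const q * fps_X) 0 = 0"
    by simp
  ultimately have "(?E oo (fps_const q * fps_X)) * ((fps_exp 1 + 1) oo (fps_const q * fps_X)) =
      (2 * fps_exp (x / q)) oo (fps_const q * fps_X)"
    by (simp only: fps_compose_mult_distrib [symmetric])
  then have "(?E oo (fps_const q * fps_X)) * (fps_exp q + 1) = 2 * fps_exp x"
    using assms
    by (simp add: fps_compose_mult_distrib fps_compose_add_distrib fps_exp_compose_linear
        flip: numeral_fps_const)
  then have "?E oo (fps_const q * fps_X) = euler_gf q x"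
    by (rule euler_gf_eqI)
  then have "fps_nth (euler_gf q x) k = fps_nth (?E oo (fps_const q * fps_X)) k"
    by simp
  then show ?thesis
    by (simp add: fps_compose_linear euler_poly_def)
qed


section \<open>Difference equation and symmetries of the coefficients\<close>

text \<open>Multiplication by \<open>2 sinh (t / 2)\<close> is the central difference in
  \<open>x\<close>; this turns residue identities into difference equations.\<close>

lemma fps_two_sinh_half_mult_euler_gf:
  "fps_two_sinh_half * euler_gf q x = euler_gf q (x + 1 / 2) - euler_gf q (x - 1 / 2)"
  using fps_exp_mult_euler_gf [of "1 / 2" q x] fps_exp_mult_euler_gf [of "- 1 / 2" q x]
  by (simp add: fps_two_sinh_half_def left_diff_distrib add.commute)

text \<open>The factor is written \<open>of_nat 2\<close> to match
  \<open>csch_residue_of_nat\<close>.\<close>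

lemma fps_deriv_two_sinh_half:
  "of_nat 2 * fps_deriv fps_two_sinh_half = fps_exp (1 / 2) + fps_exp (- 1 / 2)"
  by (rule fps_ext) (simp add: fps_two_sinh_half_def flip: numeral_fps_const)

lemma fps_deriv_compose_uminus_X:
  "fps_deriv (F oo - fps_X) = - (fps_deriv (F :: real fps) oo - fps_X)"
  by (rule fps_ext) (simp add: fps_compose_uminus_X_nth)

lemma csc_coeff_0 [simp]: "csc_coeff q 0 x = 1"
  by (simp add: csc_coeff_def)

text \<open>The second difference inserts \<open>?S * ?S\<close>. In the undifferentiated term this
  lowers the order by two. In the differentiated term, \<open>csch_residue_deriv_sinh\<close> and
  then \<open>csch_residue_deriv\<close> backwards produce the factor
  \<open>(2m + 2) / (2m)\<close>. The weights \<open>1 / (2m)\<close> and \<open>m\<close> in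
  \<open>csc_coeff\<close> fit exactly these two effects.\<close>

lemma csc_coeff_second_difference:
  "csc_coeff q (Suc m) (x + 1) - 2 * csc_coeff q (Suc m) x + csc_coeff q (Suc m) (x - 1) =
   - 4 * csc_coeff q m x"
proof -
  let ?S = fps_two_sinh_half and ?W = "euler_gf q x"
  let ?R = "\<lambda>F. csch_residue (2 * Suc m) (fps_deriv F - of_nat (Suc m) * F)"
  have D: "?S * (?S * ?W) = euler_gf q (x + 1) - of_nat 2 * ?W + euler_gf q (x - 1)"
    by (simp add: fps_two_sinh_half_mult_euler_gf right_diff_distrib) (simp add: add.commute)
  have "?R (?S * (?S * ?W)) = ?R (euler_gf q (x + 1)) - 2 * ?R ?W + ?R (euler_gf q (x - 1))"
    unfolding D
    by (simp only: fps_deriv_add fps_deriv_sub fps_deriv_mult fps_deriv_of_nat csch_residue_add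
        csch_residue_diff csch_residue_of_nat)
      (simp add: csch_residue_def algebra_simps)
  moreover have cc: "csc_coeff q (Suc m) y = (- 4) ^ Suc m / (2 * Suc m) * ?R (euler_gf q y)" for y
    by (simp add: csc_coeff_def)
  ultimately have lhs: "csc_coeff q (Suc m) (x + 1) - 2 * csc_coeff q (Suc m) x +
      csc_coeff q (Suc m) (x - 1) = (- 4) ^ Suc m / (2 * Suc m) * ?R (?S * (?S * ?W))"
    by (simp only: cc distrib_left right_diff_distrib mult.left_commute [of 2])
  have p: "2 * Suc m = Suc (2 * m + 1)"
    by simp
  have "csch_residue (2 * Suc m) (fps_deriv (?S * (?S * ?W))) =
      real (2 * Suc m) * csch_residue (2 * Suc m) (?S * (fps_deriv ?S * ?W))"
    by (subst csch_residue_deriv_sinh) (simp_all add: mult_ac)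
  also have "csch_residue (2 * Suc m) (?S * (fps_deriv ?S * ?W)) =
      csch_residue (2 * m + 1) (fps_deriv ?S * ?W)"
    unfolding p by (rule csch_residue_sinh) simp
  finally have d: "csch_residue (2 * Suc m) (fps_deriv (?S * (?S * ?W))) =
      real (2 * Suc m) * csch_residue (2 * m + 1) (fps_deriv ?S * ?W)" .
  have e: "csch_residue (2 * Suc m) (?S * (?S * ?W)) = csch_residue (2 * m + 1) (?S * ?W)"
    unfolding p by (rule csch_residue_sinh) simp
  show ?thesis
  proof (cases "m = 0")
    \<comment> \<open>Residues of order 1 are constant terms: 1 for \<open>fps_deriv ?S * ?W\<close>
      and 0 for \<open>?S * ?W\<close>.\<close>
    case True
    then show ?thesis
      unfolding lhs csch_residue_diff csch_residue_of_nat d e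
      by (simp add: csch_residue_def fps_two_sinh_half_def)
  next
    case False
    have "csch_residue (2 * m + 1) (?S * ?W) = csch_residue (2 * m) ?W"
      using False csch_residue_sinh [of "2 * m" ?W] by simp
    moreover have "csch_residue (2 * m + 1) (fps_deriv ?S * ?W) =
        csch_residue (2 * m) (fps_deriv ?W) / real (2 * m)"
      using False csch_residue_deriv [of "2 * m" ?W] by (simp add: field_simps)
    ultimately show ?thesis
      unfolding lhs csch_residue_diff csch_residue_of_nat d e
      using False by (simp add: csc_coeff_def csch_residue_diff csch_residue_of_nat field_simps)
  qed
qed

text \<open>Reflecting \<open>t\<close> replaces \<open>W' - m W\<close> at \<open>q + 1 - x\<close>
  by \<open>U' + m U\<close> at \<open>x - 1\<close>. With \<open>V\<close> at the midpoint
  \<open>x - 1/2\<close>, \<open>W - U\<close> is \<open>?S * V\<close> and \<open>W + U\<close> is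
  twice \<open>fps_deriv ?S * V\<close>, so \<open>csch_residue_deriv_sinh\<close> identifies the
  residue with that of \<open>W' - m W\<close> at \<open>x\<close>.\<close>

lemma csc_coeff_reflect: "csc_coeff q m (q + 1 - x) = csc_coeff q m x"
proof (cases "m = 0")
  case False
  let ?S = fps_two_sinh_half and ?R = "csch_residue (2 * m)"
  let ?U = "euler_gf q (x - 1)" and ?V = "euler_gf q (x - 1 / 2)" and ?W = "euler_gf q x"
  have "euler_gf q (q + 1 - x) = ?U oo - fps_X"
    by (simp add: euler_gf_compose_uminus algebra_simps)
  then have "fps_deriv (euler_gf q (q + 1 - x)) - of_nat m * euler_gf q (q + 1 - x) =
      - ((fps_deriv ?U + of_nat m * ?U) oo - fps_X)"
    by (simp add: fps_deriv_compose_uminus_X fps_compose_add_distrib fps_compose_mult_distrib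
        flip: fps_of_nat)
  then have "?R (fps_deriv (euler_gf q (q + 1 - x)) - of_nat m * euler_gf q (q + 1 - x)) =
      - ?R ((fps_deriv ?U + of_nat m * ?U) oo - fps_X)"
    by (simp add: csch_residue_def)
  \<comment> \<open>The minus sign of the chain rule cancels that of the reflected residue.\<close>
  also have "\<dots> = ?R (fps_deriv ?U + of_nat m * ?U)"
    using False by (simp add: csch_residue_compose_uminus)
  finally have r: "?R (fps_deriv (euler_gf q (q + 1 - x)) - of_nat m * euler_gf q (q + 1 - x)) =
      ?R (fps_deriv ?U) + m * ?R ?U"
    by (simp add: csch_residue_add csch_residue_of_nat)
  have "?S * ?V = ?W - ?U"
    by (simp add: fps_two_sinh_half_mult_euler_gf)
  then have "?R (fps_deriv ?W) - ?R (fps_deriv ?U) = ?R (fps_deriv (?S * ?V))"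
    by (simp add: csch_residue_diff)
  also have "\<dots> = m * ?R (of_nat 2 * (fps_deriv ?S * ?V))"
    unfolding csch_residue_of_nat using False by (subst csch_residue_deriv_sinh) simp_all
  also have "of_nat 2 * (fps_deriv ?S * ?V) = ?W + ?U"
    unfolding mult.assoc [symmetric] fps_deriv_two_sinh_half
    by (simp add: distrib_right fps_exp_mult_euler_gf)
  finally have "?R (fps_deriv ?W) - m * ?R ?W = ?R (fps_deriv ?U) + m * ?R ?U"
    by (simp add: csch_residue_add algebra_simps)
  with r show ?thesis
    by (simp add: csc_coeff_def csch_residue_diff csch_residue_of_nat)
qed simp

text \<open>The generating functions at 0 and \<open>q\<close> add up to the constant 2, whose
  derivative is 0 and whose product with an even power of csch has no residue. Reflection then moves
  \<open>q\<close> to 1.\<close>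

lemma csc_coeff_0_add_1:
  assumes "m \<noteq> 0"
  shows "csc_coeff q m 0 + csc_coeff q m 1 = 0"
proof -
  let ?R = "csch_residue (2 * m)"
  have W: "euler_gf q 0 + euler_gf q q = of_nat 2"
    using euler_gf_add_period [of q 0] by simp
  have "?R (of_nat 2 * 1) = 0"
    unfolding csch_residue_of_nat using assms
    by (simp add: csch_residue_def fps_half_csch_power_nth_odd)
  then have "?R (euler_gf q q) = - ?R (euler_gf q 0)"
    unfolding eq_neg_iff_add_eq_0 csch_residue_add [symmetric]
    by (simp only: add.commute [of "euler_gf q q"] W mult_1_right)
  moreover have "?R (fps_deriv (euler_gf q q)) = - ?R (fps_deriv (euler_gf q 0))"
    unfolding eq_neg_iff_add_eq_0 csch_residue_add [symmetric] fps_deriv_add [symmetric]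
    by (simp only: add.commute [of "euler_gf q q"] W fps_deriv_of_nat)
      (simp add: csch_residue_def)
  ultimately have "csc_coeff q m 0 + csc_coeff q m q = 0"
    using assms
    by (simp add: csc_coeff_def csch_residue_diff csch_residue_of_nat
        flip: add_divide_distrib distrib_left)
  then show ?thesis
    using csc_coeff_reflect [of q m 1] by simp
qed

section \<open>Sine sums and the expansion of odd cosecant powers\<close>

text \<open>Telescoping, by \<open>sin a ^ 2 - sin b ^ 2 = sin (a + b) * sin (a - b)\<close> at
  consecutive multiples of \<open>x\<close>.\<close>

lemma sum_sin_odd_multiples:
  "(\<Sum>j = 1..h. sin ((2 * real j - 1) * x)) * sin x = sin (real h * x) ^ 2"
proof (induction h)
  case (Suc h)
  have "sin a ^ 2 - sin b ^ 2 = sin (a + b) * sin (a - b)" for a b :: real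
    using sin_cos_squared_add [of a] sin_cos_squared_add [of b]
    unfolding sin_add sin_diff by algebra
  from this [of "real (Suc h) * x" "real h * x"]
  have "sin (real (Suc h) * x) ^ 2 - sin (real h * x) ^ 2 =
      sin ((2 * real (Suc h) - 1) * x) * sin x"
    by (simp add: algebra_simps)
  with Suc show ?case
    by (simp add: distrib_right del: of_nat_Suc)
qed simp

text \<open>A discrete Green identity: each summand is a difference of consecutive values of
  \<open>c r * s (r + 1) - s r * c (r + 1)\<close>.\<close>

lemma sum_by_parts_second_difference:
  fixes c s :: "real \<Rightarrow> real"
  shows "(\<Sum>r = 1..q. c (real r) * (s (real r + 1) - 2 * s (real r) + s (real r - 1)) -
      s (real r) * (c (real r + 1) - 2 * c (real r) + c (real r - 1))) =
    (c (real q) * s (real q + 1) - s (real q) * c (real q + 1)) - (c 0 * s 1 - s 0 * c 1)"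
  by (induction q) (simp_all add: algebra_simps)

lemma csc_power_sine_expansion:
  assumes "cos (2 * real q * \<theta>) = - 1" and "sin \<theta> \<noteq> 0"
  shows "(\<Sum>r = 1..q. csc_coeff (real q) m (real r) * sin ((2 * real r - 1) * \<theta>)) =
    1 / sin \<theta> ^ (2 * m + 1)"
proof (induction m)
  case 0
  have "sin (real q * \<theta>) ^ 2 = 1"
    using assms(1) cos_double_sin [of "real q * \<theta>"] by (simp add: mult.assoc)
  then show ?case
    using assms(2) sum_sin_odd_multiples [of \<theta> q] by (simp add: field_simps)
next
  case (Suc m)
  let ?c = "csc_coeff (real q) (Suc m)" and ?s = "\<lambda>r. sin ((2 * r - 1) * \<theta>)"
  have s: "?s (r + 1) - 2 * ?s r + ?s (r - 1) = - 4 * sin \<theta> ^ 2 * ?s r" for r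
  proof -
    have "?s (r + 1) = sin ((2 * r - 1) * \<theta> + 2 * \<theta>)" "?s (r - 1) = sin ((2 * r - 1) * \<theta> - 2 * \<theta>)"
      by (simp_all add: algebra_simps)
    moreover have "sin (y + 2 * \<theta>) - 2 * sin y + sin (y - 2 * \<theta>) = - 4 * sin \<theta> ^ 2 * sin y" for y
      by (simp only: sin_add sin_diff cos_double_sin) (simp add: algebra_simps)
    ultimately show ?thesis
      by simp
  qed
  \<comment> \<open>Both \<open>?c\<close> and \<open>?s\<close> change sign from \<open>q\<close>
    to \<open>q + 1\<close> and from 0 to 1, so both boundary terms of the summation by parts
    vanish.\<close>
  have "sin (2 * real q * \<theta>) = 0"
    using assms(1) sin_cos_squared_add [of "2 * real q * \<theta>"] by simp
  moreover have "?s (real q + 1) = sin (2 * real q * \<theta> + \<theta>)" "?s (real q) = sin (2 * real q * \<theta> - \<theta>)"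
    by (simp_all add: algebra_simps)
  ultimately have "?s (real q + 1) = - ?s (real q)"
    using assms(1) by (simp add: sin_add sin_diff)
  moreover have "?c (real q + 1) = - ?c (real q)"
    using csc_coeff_reflect [of "real q" "Suc m" 0] csc_coeff_reflect [of "real q" "Suc m" 1]
      csc_coeff_0_add_1 [of "Suc m" "real q"] by simp
  moreover have "?c 0 * ?s 1 - ?s 0 * ?c 1 = 0"
    using csc_coeff_0_add_1 [of "Suc m" "real q"] by (simp add: algebra_simps flip: distrib_left)
  ultimately have "(\<Sum>r = 1..q. ?c (real r) * (- 4 * sin \<theta> ^ 2 * ?s (real r)) -
      ?s (real r) * (- 4 * csc_coeff (real q) m (real r))) = 0"
    using sum_by_parts_second_difference [of ?c ?s q]
    by (simp only: s csc_coeff_second_difference) simp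
  also have "(\<Sum>r = 1..q. ?c (real r) * (- 4 * sin \<theta> ^ 2 * ?s (real r)) -
      ?s (real r) * (- 4 * csc_coeff (real q) m (real r))) =
    (\<Sum>r = 1..q. 4 * (csc_coeff (real q) m (real r) * ?s (real r) -
      sin \<theta> ^ 2 * (?c (real r) * ?s (real r))))"
    by (simp add: algebra_simps)
  finally have reduce: "sin \<theta> ^ 2 * (\<Sum>r = 1..q. ?c (real r) * ?s (real r)) =
      (\<Sum>r = 1..q. csc_coeff (real q) m (real r) * ?s (real r))"
    by (simp only: sum_distrib_left [symmetric] sum_subtractf) simp
  have "(\<Sum>r = 1..q. ?c (real r) * ?s (real r)) =
      (\<Sum>r = 1..q. csc_coeff (real q) m (real r) * ?s (real r)) / sin \<theta> ^ 2"
    using assms(2) by (subst reduce [symmetric]) simp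
  then show ?case
    unfolding Suc.IH by (simp add: power2_eq_square mult_ac)
qed

text \<open>Here \<open>q = 2 * h\<close>, so the left-hand sum runs over half of the
  angles.\<close>

lemma sum_csc_odd_powers:
  fixes h :: nat
  assumes "h \<ge> 1"
  defines "\<theta> \<equiv> \<lambda>j. (2 * real j - 1) * pi / real (4 * h)"
  shows "(\<Sum>j = 1..h. 1 / sin (\<theta> j) ^ (2 * m + 1)) =
    (\<Sum>j = 1..h. csc_coeff (real (2 * h)) m (real j) * (1 / sin (\<theta> j)))"
proof -
  let ?c = "\<lambda>r. csc_coeff (real (2 * h)) m (real r)"
  have pos: "sin (\<theta> j) > 0" if "j \<in> {1..2 * h}" for j
  proof (rule sin_gt_zero)
    have "2 * real j - 1 < real (4 * h)" "2 * real j - 1 > 0"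
      using that by auto
    moreover from this have "(2 * real j - 1) * pi < real (4 * h) * pi"
      by (intro mult_strict_right_mono) simp_all
    ultimately show "0 < \<theta> j" "\<theta> j < pi"
      using assms(1) by (simp_all add: \<theta>_def pos_divide_less_eq mult.commute)
  qed
  have cos: "cos (2 * real (2 * h) * \<theta> j) = - 1" for j
  proof -
    have "2 * real (2 * h) * \<theta> j = 2 * real j * pi - pi"
      using assms(1) by (simp add: \<theta>_def left_diff_distrib)
    then show ?thesis
      by (simp only: cos_diff cos_2npi) simp
  qed
  \<comment> \<open>As \<open>(2r - 1) \<theta> j = (2j - 1) \<theta> r\<close>, this is a sum of
    odd multiples of \<open>\<theta> r\<close>; its closed form has
    \<open>sin (h \<theta> r) ^ 2 = 1/2\<close>, because \<open>h \<theta> r\<close> is an odd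
    multiple of \<open>pi / 4\<close>.\<close>
  have half: "(\<Sum>j = 1..h. sin ((2 * real r - 1) * \<theta> j)) = 1 / 2 * (1 / sin (\<theta> r))"
    if "r \<in> {1..2 * h}" for r
  proof -
    have "2 * (real h * \<theta> r) = real r * pi - pi / 2"
      using assms(1) by (simp add: \<theta>_def field_simps)
    then have "cos (2 * (real h * \<theta> r)) = 0"
      by (simp add: cos_diff)
    then have "sin (real h * \<theta> r) ^ 2 = 1 / 2"
      by (simp add: cos_double_sin)
    moreover have "(2 * real r - 1) * \<theta> j = (2 * real j - 1) * \<theta> r" for j
      by (simp add: \<theta>_def)
    ultimately have "(\<Sum>j = 1..h. sin ((2 * real r - 1) * \<theta> j)) * sin (\<theta> r) = 1 / 2"
      using sum_sin_odd_multiples [of "\<theta> r" h] by simp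
    with pos [OF that] show ?thesis
      by (simp add: nonzero_eq_divide_eq)
  qed
  have "(\<Sum>j = 1..h. 1 / sin (\<theta> j) ^ (2 * m + 1)) =
      (\<Sum>j = 1..h. \<Sum>r = 1..2 * h. ?c r * sin ((2 * real r - 1) * \<theta> j))"
  proof (rule sum.cong)
    fix j assume "j \<in> {1..h}"
    then have "sin (\<theta> j) \<noteq> 0"
      using pos [of j] by simp
    then show "1 / sin (\<theta> j) ^ (2 * m + 1) =
        (\<Sum>r = 1..2 * h. ?c r * sin ((2 * real r - 1) * \<theta> j))"
      by (rule csc_power_sine_expansion [OF cos, symmetric])
  qed simp
  also have "\<dots> = (\<Sum>r = 1..2 * h. ?c r * (\<Sum>j = 1..h. sin ((2 * real r - 1) * \<theta> j)))"
    by (subst sum.swap) (simp add: sum_distrib_left)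
  also have "\<dots> = (\<Sum>r = 1..2 * h. 1 / 2 * (?c r * (1 / sin (\<theta> r))))"
  proof (rule sum.cong [OF refl])
    fix r assume r: "r \<in> {1..2 * h}"
    show "?c r * (\<Sum>j = 1..h. sin ((2 * real r - 1) * \<theta> j)) = 1 / 2 * (?c r * (1 / sin (\<theta> r)))"
      unfolding half [OF r] by simp
  qed
  also have "\<dots> = (\<Sum>r = 1..h. 1 / 2 * (?c r * (1 / sin (\<theta> r)))) +
      (\<Sum>r = h + 1..2 * h. 1 / 2 * (?c r * (1 / sin (\<theta> r))))"
    unfolding mult_2 by (rule sum.ub_add_nat) simp
  \<comment> \<open>The reflection of \<open>r\<close> to \<open>2h + 1 - r\<close> preserves both
    the coefficient and the sine, so the upper half doubles the lower one and absorbs the factor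
    1/2.\<close>
  also have "(\<Sum>r = h + 1..2 * h. 1 / 2 * (?c r * (1 / sin (\<theta> r)))) =
      (\<Sum>r = 1..h. 1 / 2 * (?c r * (1 / sin (\<theta> r))))"
  proof (rule sum.reindex_bij_witness [of _ "\<lambda>r. 2 * h + 1 - r" "\<lambda>r. 2 * h + 1 - r"])
    fix r assume r: "r \<in> {h + 1..2 * h}"
    then have e: "real (2 * h + 1 - r) = real (2 * h) + 1 - real r"
      by (simp add: of_nat_diff)
    have "\<theta> (2 * h + 1 - r) = pi - \<theta> r"
      unfolding \<theta>_def e using assms(1) by (simp add: field_simps)
    then show "1 / 2 * (?c (2 * h + 1 - r) * (1 / sin (\<theta> (2 * h + 1 - r)))) =
        1 / 2 * (?c r * (1 / sin (\<theta> r)))"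
      by (simp only: e csc_coeff_reflect sin_pi_minus)
  qed auto
  finally show ?thesis
    by (simp only: sum_distrib_left [symmetric])
qed

section \<open>Two evaluations of the residue by Bernoulli and Euler polynomials\<close>

lemma sum_split_parity:
  "(\<Sum>i<2 * m. f i) = (\<Sum>k<m. f (2 * k) + f (2 * k + 1))" for f :: "nat \<Rightarrow> 'a::comm_monoid_add"
  by (induction m) (simp_all add: add_ac)

lemma minus_4_power: "(- 4) ^ m = (- 1) ^ m * (2 :: real) ^ (2 * m)"
  by (simp add: power_mult flip: power_mult_distrib)

lemma fact_double_reduce: "m \<ge> 1 \<Longrightarrow> (fact (2 * m) :: real) = real (2 * m) * fact (2 * m - 1)"
  by (rule fact_reduce) simp

text \<open>The Cauchy product of the csch power with \<open>W' - m W\<close>; only even indices of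
  the even first factor survive.\<close>

lemma csc_coeff_eq_euler_at:
  assumes "m \<ge> 1" and "q \<noteq> 0"
  shows "csc_coeff q m x = (- 1) ^ m * ((2 * q) ^ (2 * m) / fact (2 * m)) *
    (\<Sum>k = 0..m - 1.
       1 / q ^ (2 * k + 1) * real ((2 * m - 1) choose (2 * k)) *
       gen_bernoulli (real (2 * m)) (2 * k) (real m) *
       (q * euler_poly (2 * m - 2 * k) (x / q) - real m * euler_poly (2 * m - 2 * k - 1) (x / q)))"
    (is "_ = _ * (\<Sum>k = 0..m - 1. ?f k)")
proof -
  let ?A = "fps_half_csch ^ (2 * m)"
  let ?F = "fps_deriv (euler_gf q x) - of_nat m * euler_gf q x"
  have "csch_residue (2 * m) ?F = (\<Sum>i<2 * m. fps_nth ?A i * fps_nth ?F (2 * m - 1 - i))"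
    unfolding csch_residue_def fps_mult_nth using assms(1) by (intro sum.cong) auto
  also have "\<dots> = (\<Sum>k<m. fps_nth ?A (2 * k) * fps_nth ?F (2 * m - 1 - 2 * k))"
    by (simp add: sum_split_parity fps_half_csch_power_nth_odd)
  also have "\<dots> = (\<Sum>k<m. q ^ (2 * m) / fact (2 * m - 1) * ?f k)"
  proof (rule sum.cong [OF refl])
    fix k assume "k \<in> {..<m}"
    \<comment> \<open>The complementary index \<open>i = 2m - 1 - 2k\<close> turns all truncated
      differences into sums.\<close>
    then obtain i where i: "2 * m = 2 * k + Suc i"
      by (metis add_Suc_right lessThan_iff less_natE mult_2 add.assoc add.left_commute)
    have A: "fps_nth ?A (2 * k) = gen_bernoulli (real (2 * m)) (2 * k) (real m) / fact (2 * k)"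
      using gen_bernoulli_half_csch [of m "2 * k" 0] by simp
    have "real (Suc i) * (q ^ Suc i * euler_poly (Suc i) (x / q) / fact (Suc i)) =
        q ^ Suc i * euler_poly (Suc i) (x / q) / fact i"
      by (simp del: of_nat_Suc)
    then have F: "fps_nth ?F i =
        q ^ i / fact i * (q * euler_poly (Suc i) (x / q) - m * euler_poly i (x / q))"
      by (simp add: euler_gf_nth [OF assms(2)] right_diff_distrib diff_divide_distrib mult_ac
          flip: fps_of_nat)
    have e: "2 * m - 1 - 2 * k = i" "2 * m - 2 * k = Suc i" "2 * m - 2 * k - 1 = i"
        "2 * m - 1 = 2 * k + i" "q ^ (2 * m) = q ^ i * q ^ (2 * k + 1)"
      unfolding i by (simp_all add: power_add)
    have b: "real ((2 * k + i) choose (2 * k)) = fact (2 * k + i) / (fact (2 * k) * fact i)"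
      by (subst binomial_fact) simp_all
    show "fps_nth ?A (2 * k) * fps_nth ?F (2 * m - 1 - 2 * k) =
        q ^ (2 * m) / fact (2 * m - 1) * ?f k"
      unfolding e(1,3) unfolding e(2,4,5) A F b using assms(2) by simp
  qed
  also have "\<dots> = q ^ (2 * m) / fact (2 * m - 1) * (\<Sum>k = 0..m - 1. ?f k)"
    unfolding sum_distrib_left using assms(1) by (intro sum.cong) auto
  finally have "csc_coeff q m x = (- 4) ^ m / (2 * m) *
      (q ^ (2 * m) / fact (2 * m - 1) * (\<Sum>k = 0..m - 1. ?f k))"
    using assms(1) by (simp add: csc_coeff_def)
  also have "\<dots> = (- 1) ^ m * ((2 * q) ^ (2 * m) / fact (2 * m)) * (\<Sum>k = 0..m - 1. ?f k)"
    unfolding minus_4_power fact_double_reduce [OF assms(1)] power_mult_distrib by simp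
  finally show ?thesis .
qed

text \<open>Reflection takes 0 to \<open>q\<close>, and the two series add up to 2; hence
  \<open>euler_gf q 0 - 1\<close> is odd.\<close>

lemma euler_gf_0_nth_even:
  assumes "even k" "k > 0"
  shows "fps_nth (euler_gf q 0) k = 0"
proof -
  have "euler_gf q 0 + (euler_gf q 0 oo - fps_X) = fps_const 2"
    using euler_gf_add_period [of q 0] by (simp add: euler_gf_compose_uminus numeral_fps_const)
  then have "fps_nth (euler_gf q 0 + (euler_gf q 0 oo - fps_X)) k = 0"
    using assms(2) by simp
  with assms(1) show ?thesis
    by (simp add: fps_compose_uminus_X_nth)
qed

text \<open>Here \<open>e^(xt)\<close> is moved from \<open>W\<close> to the csch power, which
  leaves \<open>W' + (x - m) W\<close> at 0. The constant term 1 of that \<open>W\<close> yields the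
  isolated Bernoulli term. It carries no power of \<open>q\<close>, so its factor is
  \<open>2 ^ (2 * m)\<close>, from \<open>(-4) ^ m\<close>, and not
  \<open>(2 * q) ^ (2 * m)\<close>.\<close>

lemma csc_coeff_eq_bernoulli_at:
  assumes "m \<ge> 1" and "q \<noteq> 0"
  shows "csc_coeff q m x = (- 1) ^ m * (1 / fact (2 * m)) *
    (2 ^ (2 * m) * (x - real m) * gen_bernoulli (real (2 * m)) (2 * m - 1) (real m + x) +
     (2 * q) ^ (2 * m) *
     (\<Sum>k = 0..m - 1.
        euler_poly (2 * m - 2 * k - 1) 0 * (1 / q ^ (2 * k + 1)) *
        (real ((2 * m - 1) choose (2 * k + 1)) *
           gen_bernoulli (real (2 * m)) (2 * k + 1) (real m + x) +
         (x - real m) * real ((2 * m - 1) choose (2 * k)) *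
           gen_bernoulli (real (2 * m)) (2 * k) (real m + x))))"
    (is "_ = _ * (_ * _ * ?B (2 * m - 1) + _ * (\<Sum>k = 0..m - 1. ?f k))")
proof -
  let ?Z = "fps_half_csch ^ (2 * m) * fps_exp x" and ?W = "euler_gf q 0"
  let ?G = "fps_deriv ?W + fps_const (x - real m) * ?W"
  let ?F = "fps_deriv (euler_gf q x) - of_nat m * euler_gf q x"
  have Z: "fps_nth ?Z i = ?B i / fact i" for i
    unfolding gen_bernoulli_half_csch by simp
  have "euler_gf q x = fps_exp x * ?W"
    by (simp add: fps_exp_mult_euler_gf)
  then have "?F = fps_exp x * ?G"
    by (simp add: algebra_simps flip: fps_of_nat fps_const_sub)
  then have "csch_residue (2 * m) ?F = fps_nth (?Z * ?G) (2 * m - 1)"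
    by (simp add: csch_residue_def mult.assoc)
  also have "\<dots> = (\<Sum>i<2 * m. fps_nth ?Z i * fps_nth ?G (2 * m - 1 - i))"
    unfolding fps_mult_nth [of ?Z] using assms(1) by (intro sum.cong) auto
  also have "\<dots> = (\<Sum>k<m. fps_nth ?Z (2 * k) * fps_nth ?G (2 * m - 1 - 2 * k) +
      fps_nth ?Z (2 * k + 1) * fps_nth ?G (2 * m - 1 - (2 * k + 1)))"
    by (rule sum_split_parity)
  also have "\<dots> = (\<Sum>k<m. q ^ (2 * m) / fact (2 * m - 1) * ?f k +
      (if k = m - 1 then (x - real m) * ?B (2 * m - 1) / fact (2 * m - 1) else 0))"
  proof (rule sum.cong [OF refl])
    fix k assume k: "k \<in> {..<m}"
    \<comment> \<open>The even index complementary to \<open>2k + 1\<close>; it is 0 exactly for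
      \<open>k = m - 1\<close>, the one case in which the constant term of \<open>?W\<close>
      enters.\<close>
    define i where "i = 2 * (m - 1 - k)"
    have i: "2 * m = 2 * k + Suc (Suc i)" and "even i"
      using k by (auto simp: i_def)
    have w: "fps_nth ?W (Suc i) = q ^ Suc i * euler_poly (Suc i) 0 / fact (Suc i)"
      using euler_gf_nth [OF assms(2), of 0] by simp
    have G1: "fps_nth ?G (Suc i) = (x - real m) * fps_nth ?W (Suc i)"
      using \<open>even i\<close> by (simp add: euler_gf_0_nth_even)
    have G0: "fps_nth ?G i = real (Suc i) * fps_nth ?W (Suc i) +
        (if k = m - 1 then x - real m else 0)"
    proof (cases "k = m - 1")
      case True
      then have "i = 0"
        by (simp add: i_def)
      with True show ?thesis
        by simp
    next
      case False
      then have "i > 0"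
        using k by (simp add: i_def)
      with False \<open>even i\<close> show ?thesis
        by (simp add: euler_gf_0_nth_even)
    qed
    have e: "2 * m - 1 - 2 * k = Suc i" "2 * m - 1 - (2 * k + 1) = i" "2 * m - 2 * k - 1 = Suc i"
        "2 * m - 1 = 2 * k + Suc i" "q ^ (2 * m) = q ^ Suc i * q ^ (2 * k + 1)"
      unfolding i by (simp_all add: power_add)
    have b0: "real ((2 * k + Suc i) choose (2 * k)) =
        fact (2 * k + Suc i) / (fact (2 * k) * fact (Suc i))"
      by (subst binomial_fact) simp_all
    \<comment> \<open>Put over \<open>fact (Suc i)\<close> so that the factor \<open>Suc i\<close>
      is the one that differentiation produces in \<open>G0\<close>.\<close>
    have b1: "real ((2 * k + Suc i) choose (2 * k + 1)) =
        fact (2 * k + Suc i) * real (Suc i) / (fact (2 * k + 1) * fact (Suc i))"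
      by (subst binomial_fact) simp_all
    have last: "2 * m - 1 = 2 * k + 1" if "k = m - 1"
      using that assms(1) by simp
    have "fps_nth ?Z (2 * k) * fps_nth ?G (Suc i) + fps_nth ?Z (2 * k + 1) * fps_nth ?G i =
        q ^ (2 * m) / fact (2 * k + Suc i) * ?f k +
        (if k = m - 1 then (x - real m) * ?B (2 * k + 1) / fact (2 * k + 1) else 0)"
      unfolding Z G0 G1 w e b0 b1 using assms(2)
      by (simp add: distrib_left distrib_right add_divide_distrib mult_ac del: fact_Suc of_nat_Suc)
    moreover have "(if k = m - 1 then (x - real m) * ?B (2 * k + 1) / fact (2 * k + 1) else 0) =
        (if k = m - 1 then (x - real m) * ?B (2 * m - 1) / fact (2 * m - 1) else 0)"
      by (rule if_cong) (simp_all only: last)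
    ultimately show "fps_nth ?Z (2 * k) * fps_nth ?G (2 * m - 1 - 2 * k) +
        fps_nth ?Z (2 * k + 1) * fps_nth ?G (2 * m - 1 - (2 * k + 1)) =
        q ^ (2 * m) / fact (2 * m - 1) * ?f k +
        (if k = m - 1 then (x - real m) * ?B (2 * m - 1) / fact (2 * m - 1) else 0)"
      unfolding e(1,2) by (simp only: e(4))
  qed
  also have "\<dots> = q ^ (2 * m) / fact (2 * m - 1) * (\<Sum>k = 0..m - 1. ?f k) +
      (x - real m) * ?B (2 * m - 1) / fact (2 * m - 1)"
  proof -
    have "{0..m - 1} = {..<m}"
      using assms(1) by auto
    then show ?thesis
      using assms(1) by (simp add: sum.distrib sum_distrib_left)
  qed
  finally have "csc_coeff q m x = (- 4) ^ m / (2 * m) *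
      (q ^ (2 * m) / fact (2 * m - 1) * (\<Sum>k = 0..m - 1. ?f k) +
       (x - real m) * ?B (2 * m - 1) / fact (2 * m - 1))"
    using assms(1) by (simp add: csc_coeff_def)
  also have "\<dots> = (- 1) ^ m * (1 / fact (2 * m)) * (2 ^ (2 * m) * (x - real m) * ?B (2 * m - 1) +
      (2 * q) ^ (2 * m) * (\<Sum>k = 0..m - 1. ?f k))"
    unfolding minus_4_power fact_double_reduce [OF assms(1)] power_mult_distrib
    by (simp add: distrib_left add_divide_distrib)
  finally show ?thesis .
qed

theorem theorem4p1:
  fixes m n :: nat
  assumes "m \<ge> 1" and "n \<ge> 2"
  shows
    "csc_sum (2 * m + 1) n =
       (-1) ^ m * (2 ^ (2 * m * n) / fact (2 * m)) *
       (\<Sum>j = 1..2 ^ (n - 2).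
          (\<Sum>k = 0..m - 1.
             1 / 2 ^ ((n - 1) * (2 * k + 1)) * real ((2 * m - 1) choose (2 * k)) *
             gen_bernoulli (real (2 * m)) (2 * k) (real m) *
             (2 ^ (n - 1) * euler_poly (2 * m - 2 * k) (real j / 2 ^ (n - 1)) -
              real m * euler_poly (2 * m - 2 * k - 1) (real j / 2 ^ (n - 1)))) *
          (1 / sin ((2 * real j - 1) * pi / 2 ^ n)))
     \<and>
     csc_sum (2 * m + 1) n =
       (-1) ^ m * (1 / fact (2 * m)) *
       (\<Sum>j = 1..2 ^ (n - 2).
          (2 ^ (2 * m) * (real j - real m) *
             gen_bernoulli (real (2 * m)) (2 * m - 1) (real m + real j) +
           2 ^ (2 * m * n) *
           (\<Sum>k = 0..m - 1.
              euler_poly (2 * m - 2 * k - 1) 0 * (1 / 2 ^ ((n - 1) * (2 * k + 1))) *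
              (real ((2 * m - 1) choose (2 * k + 1)) *
                 gen_bernoulli (real (2 * m)) (2 * k + 1) (real m + real j) +
               (real j - real m) * real ((2 * m - 1) choose (2 * k)) *
                 gen_bernoulli (real (2 * m)) (2 * k) (real m + real j)))) *
          (1 / sin ((2 * real j - 1) * pi / 2 ^ n)))"
proof -
  \<comment> \<open>Thus \<open>q = 2 * h = 2 ^ (n - 1)\<close> and \<open>4 * h = 2 ^ n\<close>;
    \<open>n \<ge> 2\<close> keeps the exponent \<open>n - 2\<close> from being truncated.\<close>
  define h :: nat where "h = 2 ^ (n - 2)"
  have h: "h \<ge> 1" "2 ^ (n - 1) = real (2 * h)"
    using assms(2) by (auto simp: h_def Suc_diff_le [symmetric] simp flip: power_Suc)
  have N: "2 ^ n = 2 * (2::real) ^ (n - 1)"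
    using assms(2) by (simp flip: power_Suc)
  have "2 ^ n = real (4 * h)"
    unfolding N h(2) by simp
  then have angle: "(2 * real j - 1) * pi / 2 ^ n = (2 * real j - 1) * pi / real (4 * h)" for j
    by (simp only:)
  \<comment> \<open>Both claimed formulas come from this sum by rewriting its coefficients
    alone.\<close>
  have S: "csc_sum (2 * m + 1) n = (\<Sum>j = 1..2 ^ (n - 2). csc_coeff (2 ^ (n - 1)) m (real j) *
      (1 / sin ((2 * real j - 1) * pi / 2 ^ n)))"
    unfolding csc_sum_def angle h(2) unfolding h_def [symmetric]
    by (rule sum_csc_odd_powers [OF h(1)])
  have p1: "(2 * (2::real) ^ (n - 1)) ^ (2 * m) = 2 ^ (2 * m * n)"
    unfolding N [symmetric] by (simp only: mult.commute power_mult [symmetric])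
  have p2: "(2 ^ (n - 1)) ^ (2 * k + 1) = (2::real) ^ ((n - 1) * (2 * k + 1))" for k
    by (simp only: power_mult)
  have q: "(2::real) ^ (n - 1) \<noteq> 0"
    by simp
  show ?thesis
  proof (rule conjI, goal_cases)
    case 1
    show ?case
      unfolding S csc_coeff_eq_euler_at [OF assms(1) q] p1 p2
      by (simp only: mult.assoc sum_distrib_left [symmetric])
  next
    case 2
    show ?case
      unfolding S csc_coeff_eq_bernoulli_at [OF assms(1) q] p1 p2
      by (simp only: mult.assoc sum_distrib_left [symmetric])
  qed
qed

end
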